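(* Let $N$ and $v$ be integers with $2\le v\le N+1$. Then (1) $\mathrm{LAK}_{(1,\bar1)}(N,v)=\mathrm{LAK}_{(1,1)}(N,v)$ if $v\ge3$, and $\mathrm{LAK}_{(1,\bar1)}(N,2)=2^{N-1}-1$; (2) $\mathrm{LAK}_{(\bar1,\bar1)}(N,v)=\mathrm{LAK}_{(\bar1,1)}(N,v)$ when $v\le N$.
   Context: Let $A$ be an $N\times k$ array with entries in each column from a $v$-element symbol set. A 1-way interaction is a set $\{(\gamma,\sigma)\}$ with $\gamma$ a column and $\sigma$ a symbol, with $\rho_A(\{(\gamma,\sigma)\})=\{r:A_{r\gamma}=\sigma\}$; the 0-way interaction $\sqcup$ is the empty set of (column, symbol) pairs, with $\rho_A(\sqcup)=\{1,\dots,N\}$. Let $\mathcal I_1$ be the set of 1-way interactions and $\overline{\mathcal I_1}=\mathcal I_1\cup\{\sqcup\}$. For a set $\mathcal T$ of interactions, $\rho_A(\mathcal T)=\bigcup_{T\in\mathcal T}\rho_A(T)$ (so the empty set of interactions has $\rho_A=\emptyset$). A set $\mathcal T\subseteq\overline{\mathcal I_1}$ is independent if there are no $T,T'\in\mathcal T$ with $T\subsetneq T'$. $A$ is a $(1,1)$-LA if $\rho_A(\mathcal T_1)=\rho_A(\mathcal T_2)\iff\mathcal T_1=\mathcal T_2$ for all $\mathcal T_1,\mathcal T_2\subseteq\mathcal I_1$ with $|\mathcal T_1|=|\mathcal T_2|=1$; a $(\bar1,1)$-LA if this holds for all $\mathcal T_1,\mathcal T_2\subseteq\mathcal I_1$ of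 size at most $1$; a $(1,\bar1)$-LA if it holds for all independent $\mathcal T_1,\mathcal T_2\subseteq\overline{\mathcal I_1}$ of size exactly $1$; a $(\bar1,\bar1)$-LA if it holds for all independent $\mathcal T_1,\mathcal T_2\subseteq\overline{\mathcal I_1}$ of size at most $1$. For each variant $X\in\{(1,1),(\bar1,1),(1,\bar1),(\bar1,\bar1)\}$, $\mathrm{LAK}_X(N,v)$ is the largest $k$ such that an $X$-locating array with $N$ rows, $k$ columns and $v$ symbols exists. *)

theory Defs
  imports Main
begin

text \<open>An array with \<^term>\<open>N\<close> rows and \<^term>\<open>k\<close> columns is a function \<^term>\<open>A\<close> of a row in
  \<^term>\<open>{1..N}\<close> and a column in \<^term>\<open>{1..k}\<close>; its values elsewhere are irrelevant. \<^term>\<open>S c\<close> is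
  the symbol set of column \<^term>\<open>c\<close>. Arrays without columns are allowed.\<close>

type_synonym interaction = "(nat \<times> nat) set"

definition is_array :: "nat \<Rightarrow> nat \<Rightarrow> nat \<Rightarrow> (nat \<Rightarrow> nat set) \<Rightarrow> (nat \<Rightarrow> nat \<Rightarrow> nat) \<Rightarrow> bool" where
  "is_array N k v S A \<longleftrightarrow>
     (\<forall>c\<in>{1..k}. finite (S c) \<and> card (S c) = v) \<and>
     (\<forall>r\<in>{1..N}. \<forall>c\<in>{1..k}. A r c \<in> S c)"

definition I1 :: "nat \<Rightarrow> (nat \<Rightarrow> nat set) \<Rightarrow> interaction set" where
  "I1 k S = {{(c, s)} | c s. c \<in> {1..k} \<and> s \<in> S c}"

definition I1bar :: "nat \<Rightarrow> (nat \<Rightarrow> nat set) \<Rightarrow> interaction set" where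
  "I1bar k S = I1 k S \<union> {{}}"

definition rho :: "nat \<Rightarrow> (nat \<Rightarrow> nat \<Rightarrow> nat) \<Rightarrow> interaction \<Rightarrow> nat set" where
  "rho N A T = {r \<in> {1..N}. \<forall>(c, s)\<in>T. A r c = s}"

definition rho_set :: "nat \<Rightarrow> (nat \<Rightarrow> nat \<Rightarrow> nat) \<Rightarrow> interaction set \<Rightarrow> nat set" where
  "rho_set N A \<T> = (\<Union>T\<in>\<T>. rho N A T)"

lemma rho_singleton: "rho N A {(c, s)} = {r \<in> {1..N}. A r c = s}"
  by (simp add: rho_def)

lemma rho_empty: "rho N A {} = {1..N}"
  by (auto simp: rho_def)

definition independent :: "interaction set \<Rightarrow> bool" where
  "independent \<T> \<longleftrightarrow> \<not> (\<exists>T\<in>\<T>. \<exists>T'\<in>\<T>. T \<subset> T')"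

definition locates :: "nat \<Rightarrow> (nat \<Rightarrow> nat \<Rightarrow> nat) \<Rightarrow> interaction set set \<Rightarrow> bool" where
  "locates N A \<F> \<longleftrightarrow> (\<forall>\<T>1\<in>\<F>. \<forall>\<T>2\<in>\<F>. rho_set N A \<T>1 = rho_set N A \<T>2 \<longleftrightarrow> \<T>1 = \<T>2)"

text \<open>In the names of the variants, \<open>b1\<close> stands for a barred 1.\<close>

definition LA_1_1 :: "nat \<Rightarrow> nat \<Rightarrow> (nat \<Rightarrow> nat set) \<Rightarrow> (nat \<Rightarrow> nat \<Rightarrow> nat) \<Rightarrow> bool" where
  "LA_1_1 N k S A \<longleftrightarrow> locates N A {\<T>. \<T> \<subseteq> I1 k S \<and> card \<T> = 1}"

definition LA_b1_1 :: "nat \<Rightarrow> nat \<Rightarrow> (nat \<Rightarrow> nat set) \<Rightarrow> (nat \<Rightarrow> nat \<Rightarrow> nat) \<Rightarrow> bool" where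
  "LA_b1_1 N k S A \<longleftrightarrow> locates N A {\<T>. \<T> \<subseteq> I1 k S \<and> finite \<T> \<and> card \<T> \<le> 1}"

definition LA_1_b1 :: "nat \<Rightarrow> nat \<Rightarrow> (nat \<Rightarrow> nat set) \<Rightarrow> (nat \<Rightarrow> nat \<Rightarrow> nat) \<Rightarrow> bool" where
  "LA_1_b1 N k S A \<longleftrightarrow> locates N A {\<T>. \<T> \<subseteq> I1bar k S \<and> independent \<T> \<and> card \<T> = 1}"

definition LA_b1_b1 :: "nat \<Rightarrow> nat \<Rightarrow> (nat \<Rightarrow> nat set) \<Rightarrow> (nat \<Rightarrow> nat \<Rightarrow> nat) \<Rightarrow> bool" where
  "LA_b1_b1 N k S A \<longleftrightarrow>
     locates N A {\<T>. \<T> \<subseteq> I1bar k S \<and> independent \<T> \<and> finite \<T> \<and> card \<T> \<le> 1}"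

definition LA_exists ::
    "(nat \<Rightarrow> nat \<Rightarrow> (nat \<Rightarrow> nat set) \<Rightarrow> (nat \<Rightarrow> nat \<Rightarrow> nat) \<Rightarrow> bool) \<Rightarrow> nat \<Rightarrow> nat \<Rightarrow> nat \<Rightarrow> bool" where
  "LA_exists X N k v \<longleftrightarrow> (\<exists>S A. is_array N k v S A \<and> X N k S A)"

definition LAK ::
    "(nat \<Rightarrow> nat \<Rightarrow> (nat \<Rightarrow> nat set) \<Rightarrow> (nat \<Rightarrow> nat \<Rightarrow> nat) \<Rightarrow> bool) \<Rightarrow> nat \<Rightarrow> nat \<Rightarrow> nat" where
  "LAK X N v = (GREATEST k. LA_exists X N k v)"

text \<open>The maximum in the definition of \<^const>\<open>LAK\<close> exists for each of the four variants.\<close>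

lemma locates_mono: "locates N A \<F> \<Longrightarrow> \<G> \<subseteq> \<F> \<Longrightarrow> locates N A \<G>"
  unfolding locates_def by blast

lemma independent_card_le_1:
  assumes "finite \<T>" "card \<T> \<le> 1"
  shows "independent \<T>"
proof -
  have "T = T'" if "T \<in> \<T>" "T' \<in> \<T>" for T T'
    using assms(2) that by (simp add: card_le_Suc0_iff_eq[OF assms(1)])
  then show ?thesis
    unfolding independent_def by blast
qed

lemma LA_imp_LA_1_1:
  assumes "X \<in> {LA_1_1, LA_b1_1, LA_1_b1, LA_b1_b1}" "X N k S A"
  shows "LA_1_1 N k S A"
proof -
  have "independent \<T>" if "card \<T> = 1" for \<T>
    using that by (simp add: independent_card_le_1 card_ge_0_finite)
  moreover have "finite \<T>" if "card \<T> = 1" for \<T> :: "interaction set"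
    using that by (simp add: card_ge_0_finite)
  ultimately show ?thesis
    using assms unfolding LA_1_1_def
    by (elim insertE emptyE)
      (auto simp: LA_1_1_def LA_b1_1_def LA_1_b1_def LA_b1_b1_def I1bar_def
        intro: locates_mono)
qed

lemma LA_1_1_bound:
  assumes "is_array N k v S A" "LA_1_1 N k S A" "v > 0"
  shows "k \<le> 2 ^ N"
proof -
  define s where "s c = (SOME x. x \<in> S c)" for c
  have s: "s c \<in> S c" if "c \<in> {1..k}" for c
  proof -
    have "card (S c) = v"
      using that assms(1) unfolding is_array_def by blast
    then have "S c \<noteq> {}"
      using assms(3) by (intro notI) simp
    then show ?thesis
      unfolding s_def by (simp add: some_in_eq)
  qed
  have "inj_on (\<lambda>c. rho N A {(c, s c)}) {1..k}"
  proof (rule inj_onI)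
    fix c d assume cd: "c \<in> {1..k}" "d \<in> {1..k}" "rho N A {(c, s c)} = rho N A {(d, s d)}"
    let ?F = "{\<T>. \<T> \<subseteq> I1 k S \<and> card \<T> = 1}"
    have mem: "{{(c, s c)}} \<in> ?F" "{{(d, s d)}} \<in> ?F"
      using cd(1,2) s by (simp_all add: I1_def)
    have "rho_set N A {{(c, s c)}} = rho_set N A {{(d, s d)}}"
      using cd(3) by (simp add: rho_set_def)
    moreover have "locates N A ?F"
      using assms(2) by (simp only: LA_1_1_def)
    ultimately have "{{(c, s c)}} = {{(d, s d)}}"
      using mem by (simp only: locates_def)
    then show "c = d" by simp
  qed
  moreover have "(\<lambda>c. rho N A {(c, s c)}) ` {1..k} \<subseteq> Pow {1..N}"
    unfolding rho_def by auto
  ultimately have "card {1..k} \<le> card (Pow {1..N})"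
    by (rule card_inj_on_le) simp
  then show ?thesis by (simp add: card_Pow)
qed

lemma LA_exists_0:
  assumes "X \<in> {LA_1_1, LA_b1_1, LA_1_b1, LA_b1_b1}" "N > 0"
  shows "LA_exists X N 0 v"
proof -
  have I: "I1 0 S = {}" for S unfolding I1_def by simp
  have "LA_1_1 N 0 S A" "LA_b1_1 N 0 S A" "LA_1_b1 N 0 S A" "LA_b1_b1 N 0 S A" for S A
    using \<open>N > 0\<close> unfolding LA_1_1_def LA_b1_1_def LA_1_b1_def LA_b1_b1_def
    by (auto simp: locates_def I I1bar_def subset_singleton_iff rho_set_def rho_empty)
  then have "X N 0 S A" for S A
    using assms(1) by (elim insertE emptyE) simp_all
  then show ?thesis
    unfolding LA_exists_def is_array_def by simp
qed

lemma LAK_greatest: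
  assumes "X \<in> {LA_1_1, LA_b1_1, LA_1_b1, LA_b1_b1}" "N > 0" "v > 0"
  shows "LA_exists X N (LAK X N v) v" and "LA_exists X N k v \<Longrightarrow> k \<le> LAK X N v"
proof -
  have bound: "j \<le> 2 ^ N" if ex: "LA_exists X N j v" for j
  proof -
    obtain S A where "is_array N j v S A" "X N j S A"
      using ex unfolding LA_exists_def by auto
    then show ?thesis
      by (intro LA_1_1_bound[OF _ LA_imp_LA_1_1[OF assms(1)] assms(3)])
  qed
  show "LA_exists X N (LAK X N v) v"
    unfolding LAK_def
    by (rule GreatestI_nat[where P = "\<lambda>k. LA_exists X N k v", OF LA_exists_0[OF assms(1,2)]]) (rule bound)
  show "k \<le> LAK X N v" if "LA_exists X N k v"
    unfolding LAK_def
    by (rule Greatest_le_nat[where P = "\<lambda>k. LA_exists X N k v", OF that]) (rule bound)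
qed

end

theory Submission
  imports Defs
begin

text \<open>Locating one fault amounts to injectivity of \<^const>\<open>rho\<close>, so each column is a partition of the
  rows into \<open>v\<close> classes and all classes of all columns are distinct. The interaction \<open>\<squnion>\<close> adds only
  the condition that no class is the set of all rows. If one were, the other \<open>v - 1\<close> classes of its
  column would be empty, which is impossible when empty classes are excluded, or when \<open>v \<ge> 3\<close>.
  For \<open>v = 2\<close> a column is a set of rows together with its complement, and the admissible columns
  correspond to the nonempty sets of rows avoiding the first row.\<close>

lemma locates_singletons_iff: "locates N A ((\<lambda>T. {T}) ` F) \<longleftrightarrow> inj_on (rho N A) F"
  by (auto simp: locates_def rho_set_def inj_on_def)

lemma locates_card_eq_1_iff:
  "locates N A {\<T>. \<T> \<subseteq> F \<and> card \<T> = 1} \<longleftrightarrow> inj_on (rho N A) F"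
proof -
  have "{\<T>. \<T> \<subseteq> F \<and> card \<T> = 1} = (\<lambda>T. {T}) ` F"
    by (auto simp: card_1_singleton_iff)
  then show ?thesis
    by (simp only: locates_singletons_iff)
qed

text \<open>Each admissible \<open>\<T>\<close> is \<open>{}\<close> or a singleton. Since
  \<open>rho_set\<close> sends \<open>{}\<close> to the empty set of rows, telling it apart from the
  singletons means that no member of \<open>F\<close> has an empty row set.\<close>

lemma locates_card_le_1_iff:
  "locates N A {\<T>. \<T> \<subseteq> F \<and> finite \<T> \<and> card \<T> \<le> 1} \<longleftrightarrow>
     inj_on (rho N A) F \<and> (\<forall>T\<in>F. rho N A T \<noteq> {})"
proof -
  have "{\<T>. \<T> \<subseteq> F \<and> finite \<T> \<and> card \<T> \<le> 1} = insert {} ((\<lambda>T. {T}) ` F)"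
    by (auto simp: le_Suc_eq card_1_singleton_iff)
  moreover have "locates N A (insert {} ((\<lambda>T. {T}) ` F)) \<longleftrightarrow>
      locates N A ((\<lambda>T. {T}) ` F) \<and> (\<forall>T\<in>F. rho N A T \<noteq> {})"
    by (simp add: locates_def rho_set_def ball_conj_distrib eq_commute[of "{}"] conj_ac)
  ultimately show ?thesis
    by (simp only: locates_singletons_iff)
qed

lemma LA_1_1_iff: "LA_1_1 N k S A \<longleftrightarrow> inj_on (rho N A) (I1 k S)"
  unfolding LA_1_1_def by (rule locates_card_eq_1_iff)

lemma LA_b1_1_iff:
  "LA_b1_1 N k S A \<longleftrightarrow> inj_on (rho N A) (I1 k S) \<and> (\<forall>T\<in>I1 k S. rho N A T \<noteq> {})"
  unfolding LA_b1_1_def by (rule locates_card_le_1_iff)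

lemma inj_on_I1bar_iff:
  "inj_on (rho N A) (I1bar k S) \<longleftrightarrow>
     inj_on (rho N A) (I1 k S) \<and> (\<forall>T\<in>I1 k S. rho N A T \<noteq> {1..N})"
proof -
  have "{} \<notin> I1 k S"
    by (auto simp: I1_def)
  then show ?thesis
    by (auto simp: I1bar_def rho_empty)
qed

lemma LA_1_b1_iff:
  "LA_1_b1 N k S A \<longleftrightarrow> inj_on (rho N A) (I1 k S) \<and> (\<forall>T\<in>I1 k S. rho N A T \<noteq> {1..N})"
proof -
  have "{\<T>. \<T> \<subseteq> I1bar k S \<and> independent \<T> \<and> card \<T> = 1} = {\<T>. \<T> \<subseteq> I1bar k S \<and> card \<T> = 1}"
    by (auto intro!: independent_card_le_1 intro: card_ge_0_finite)
  then show ?thesis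
    by (simp only: LA_1_b1_def locates_card_eq_1_iff inj_on_I1bar_iff)
qed

lemma LA_b1_b1_iff:
  assumes "N > 0"
  shows "LA_b1_b1 N k S A \<longleftrightarrow>
    inj_on (rho N A) (I1 k S) \<and> (\<forall>T\<in>I1 k S. rho N A T \<noteq> {} \<and> rho N A T \<noteq> {1..N})"
proof -
  have "{\<T>. \<T> \<subseteq> I1bar k S \<and> independent \<T> \<and> finite \<T> \<and> card \<T> \<le> 1} =
      {\<T>. \<T> \<subseteq> I1bar k S \<and> finite \<T> \<and> card \<T> \<le> 1}"
    by (auto intro: independent_card_le_1)
  \<comment> \<open>Every row satisfies the interaction \<open>{}\<close>, so its row set is
    nonempty because \<open>N > 0\<close>.\<close>
  moreover have "(\<forall>T\<in>I1bar k S. rho N A T \<noteq> {}) \<longleftrightarrow> (\<forall>T\<in>I1 k S. rho N A T \<noteq> {})"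
    using assms by (auto simp: I1bar_def rho_empty)
  ultimately show ?thesis
    by (simp only: LA_b1_b1_def locates_card_le_1_iff inj_on_I1bar_iff) blast
qed

lemma rho_eq_empty_if_full:
  assumes "rho N A {(c, s)} = {1..N}" "t \<noteq> s"
  shows "rho N A {(c, t)} = {}"
proof -
  have "A r c = s" if "r \<in> {1..N}" for r
  proof -
    have "r \<in> rho N A {(c, s)}"
      using assms(1) that by blast
    then show ?thesis by (simp add: rho_singleton)
  qed
  then show ?thesis
    using assms(2) by (auto simp: rho_singleton)
qed

lemma LA_1_b1_iff_LA_1_1:
  assumes "is_array N k v S A" "v \<ge> 3"
  shows "LA_1_b1 N k S A \<longleftrightarrow> LA_1_1 N k S A"
proof -
  have "rho N A T \<noteq> {1..N}" if inj: "inj_on (rho N A) (I1 k S)" and "T \<in> I1 k S" for T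
  proof
    assume full: "rho N A T = {1..N}"
    obtain c s where cs: "T = {(c, s)}" "c \<in> {1..k}" "s \<in> S c"
      using \<open>T \<in> I1 k S\<close> by (auto simp: I1_def)
    have "finite (S c)" "card (S c) = v"
      using assms(1) cs(2) by (simp_all add: is_array_def)
    \<comment> \<open>At least two symbols differ from \<open>s\<close>. Both would have the empty
      row set, against injectivity.\<close>
    then have "\<not> card (S c - {s}) \<le> Suc 0"
      using assms(2) cs(3) by simp
    then obtain t u where tu: "t \<in> S c - {s}" "u \<in> S c - {s}" "t \<noteq> u"
      using \<open>finite (S c)\<close> by (auto simp: card_le_Suc0_iff_eq)
    have "rho N A {(c, t)} = rho N A {(c, u)}"
      using full cs(1) tu rho_eq_empty_if_full[of N A c s] by simp
    moreover have "{(c, t)} \<in> I1 k S" "{(c, u)} \<in> I1 k S"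
      using cs(2) tu by (auto simp: I1_def)
    ultimately have "{(c, t)} = {(c, u)}"
      by (rule inj_onD[OF inj])
    then show False using tu(3) by simp
  qed
  then show ?thesis
    by (auto simp: LA_1_b1_iff LA_1_1_iff)
qed

lemma LA_b1_b1_iff_LA_b1_1:
  assumes "is_array N k v S A" "v \<ge> 2" "N > 0"
  shows "LA_b1_b1 N k S A \<longleftrightarrow> LA_b1_1 N k S A"
proof -
  have "rho N A T \<noteq> {1..N}" if ne: "\<forall>T\<in>I1 k S. rho N A T \<noteq> {}" and "T \<in> I1 k S" for T
  proof
    assume full: "rho N A T = {1..N}"
    obtain c s where cs: "T = {(c, s)}" "c \<in> {1..k}" "s \<in> S c"
      using \<open>T \<in> I1 k S\<close> by (auto simp: I1_def)
    have "finite (S c)" "card (S c) = v"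
      using assms(1) cs(2) by (simp_all add: is_array_def)
    \<comment> \<open>A single further symbol suffices here, as its empty row set already
      contradicts \<open>ne\<close>.\<close>
    then have "card (S c - {s}) \<noteq> 0"
      using assms(2) cs(3) by simp
    then have "S c - {s} \<noteq> {}"
      by (metis card.empty)
    then obtain t where t: "t \<in> S c - {s}"
      by blast
    then have "{(c, t)} \<in> I1 k S"
      using cs(2) by (auto simp: I1_def)
    then show False
      using ne full cs(1) t rho_eq_empty_if_full[of N A c s t] by auto
  qed
  then show ?thesis
    using assms(3) by (auto simp: LA_b1_b1_iff LA_b1_1_iff)
qed

text \<open>Counts the codes of columns used in both the upper bound and the construction;
  \<open>{2..N}\<close> stands for all rows but the first.\<close>

lemma card_nonempty_subsets_avoiding_first:
  "card (Pow {2..N} - {{}}) = 2 ^ (N - 1) - (1::nat)"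
  by (simp add: card_Diff_singleton card_Pow)

text \<open>Encode column \<open>c\<close> by the set \<open>g c\<close> of rows that disagree with
  row 1. Its complement is the class containing row 1. These classes are distinct, so
  \<open>g\<close> is injective, and none of them is full, so \<open>g c\<close> is
  nonempty.\<close>

lemma LA_1_b1_bound:
  assumes "is_array N k v S A" "LA_1_b1 N k S A" "N > 0"
  shows "k \<le> 2 ^ (N - 1) - 1"
proof -
  define g where "g c = {r \<in> {2..N}. A r c \<noteq> A 1 c}" for c
  have rho_g: "rho N A {(c, A 1 c)} = {1..N} - g c" for c
  proof -
    have "{1..N} = insert 1 {2..N}"
      using assms(3) by auto
    then show ?thesis
      by (auto simp only: rho_singleton g_def)
  qed
  \<comment> \<open>By \<open>N > 0\<close> row 1 belongs to the array, so \<open>A 1 c\<close> is a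
    symbol of column \<open>c\<close>.\<close>
  have I: "{(c, A 1 c)} \<in> I1 k S" if "c \<in> {1..k}" for c
    using that assms(1,3) by (auto simp: I1_def is_array_def)
  have inj: "inj_on (rho N A) (I1 k S)" and full: "\<forall>T\<in>I1 k S. rho N A T \<noteq> {1..N}"
    using assms(2) by (simp_all add: LA_1_b1_iff)
  have "inj_on g {1..k}"
  proof (rule inj_onI)
    fix c d assume cd: "c \<in> {1..k}" "d \<in> {1..k}" "g c = g d"
    then have "{(c, A 1 c)} = {(d, A 1 d)}"
      by (intro inj_onD[OF inj] I) (simp_all only: rho_g)
    then show "c = d" by simp
  qed
  moreover have "g ` {1..k} \<subseteq> Pow {2..N} - {{}}"
  proof -
    have "g c \<noteq> {}" if "c \<in> {1..k}" for c
      using full I[OF that] rho_g[of c] by auto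
    moreover have "g c \<subseteq> {2..N}" for c
      by (auto simp: g_def)
    ultimately show ?thesis by blast
  qed
  ultimately have "card {1..k} \<le> card (Pow {2..N} - {{}})"
    by (rule card_inj_on_le) simp
  then show ?thesis
    by (simp only: card_nonempty_subsets_avoiding_first card_atLeastAtMost)
qed

text \<open>The columns are the indicator functions of all nonempty sets of rows that avoid row
  1.\<close>

lemma LA_1_b1_exists:
  assumes "N > 0"
  shows "LA_exists LA_1_b1 N (2 ^ (N - 1) - 1) 2"
proof -
  let ?k = "2 ^ (N - 1) - (1::nat)"
  have "card {1..?k} = card (Pow {2..N} - {{}})"
    by (simp only: card_nonempty_subsets_avoiding_first card_atLeastAtMost)
  then obtain f where f: "bij_betw f {1..?k} (Pow {2..N} - {{}})"
    using finite_same_card_bij[of "{1..?k}" "Pow {2..N} - {{}}"] by auto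
  define A :: "nat \<Rightarrow> nat \<Rightarrow> nat" where "A r c = (if r \<in> f c then 1 else 0)" for r c
  define S :: "nat \<Rightarrow> nat set" where "S c = {0, 1}" for c
  have sub: "f c \<subseteq> {2..N}" and ne: "f c \<noteq> {}" if "c \<in> {1..?k}" for c
    using bij_betwE[OF f] that by auto
  have rho1: "rho N A {(c, 1)} = f c" if "c \<in> {1..?k}" for c
    using sub[OF that] by (auto simp: rho_singleton A_def split: if_splits)
  have rho0: "rho N A {(c, 0)} = {1..N} - f c" for c
    by (auto simp: rho_singleton A_def)
  \<comment> \<open>Row 1 is constantly 0, so a class reveals its symbol by whether it contains row
    1.\<close>
  have first: "1 \<in> rho N A {(c, s)} \<longleftrightarrow> s = 0" if "c \<in> {1..?k}" "s \<in> S c" for c s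
    using that sub[OF that(1)] assms rho0[of c] rho1[OF that(1)] by (auto simp: S_def)
  \<comment> \<open>Once the symbol is known, the class determines \<open>f c\<close> and hence the
    column.\<close>
  have f_eq: "f c = (if s = 0 then {1..N} - rho N A {(c, s)} else rho N A {(c, s)})"
    if "c \<in> {1..?k}" "s \<in> S c" for c s
  proof -
    have "f c \<subseteq> {1..N}"
      using sub[OF that(1)] by fastforce
    then show ?thesis
      using that rho0[of c] rho1[OF that(1)] by (auto simp: S_def)
  qed
  have "inj_on (rho N A) (I1 ?k S)"
  proof (rule inj_onI)
    fix T U assume TU: "T \<in> I1 ?k S" "U \<in> I1 ?k S" "rho N A T = rho N A U"
    obtain c s where cs: "T = {(c, s)}" "c \<in> {1..?k}" "s \<in> S c"
      using TU(1) unfolding I1_def by blast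
    obtain d t where dt: "U = {(d, t)}" "d \<in> {1..?k}" "t \<in> S d"
      using TU(2) unfolding I1_def by blast
    have "s = 0 \<longleftrightarrow> t = 0"
      using first[OF cs(2,3)] first[OF dt(2,3)] TU(3) cs(1) dt(1) by simp
    moreover from this have "f c = f d"
      using f_eq[OF cs(2,3)] f_eq[OF dt(2,3)] TU(3) cs(1) dt(1) by simp
    then have "c = d"
      using bij_betw_imp_inj_on[OF f] cs(2) dt(2) by (auto dest: inj_onD)
    ultimately show "T = U"
      using cs dt by (auto simp: S_def)
  qed
  moreover have "rho N A T \<noteq> {1..N}" if "T \<in> I1 ?k S" for T
  proof
    assume full: "rho N A T = {1..N}"
    obtain c s where cs: "T = {(c, s)}" "c \<in> {1..?k}" "s \<in> S c"
      using \<open>T \<in> I1 ?k S\<close> unfolding I1_def by blast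
    \<comment> \<open>A full class contains row 1, so it belongs to the symbol 0 and is the
      complement of \<open>f c\<close>.\<close>
    have "s = 0"
      using first[OF cs(2,3)] full cs(1) assms by simp
    then have "f c = {}"
      using f_eq[OF cs(2,3)] full cs(1) by simp
    then show False using ne[OF cs(2)] by simp
  qed
  moreover have "is_array N ?k 2 S A"
    by (simp add: is_array_def S_def A_def)
  ultimately show ?thesis
    unfolding LA_exists_def LA_1_b1_iff by blast
qed

theorem theorem6p2:
  fixes N v :: nat
  assumes "2 \<le> v" and "v \<le> N + 1"
  shows "(v \<ge> 3 \<longrightarrow> LAK LA_1_b1 N v = LAK LA_1_1 N v) \<and>
         LAK LA_1_b1 N 2 = 2 ^ (N - 1) - 1 \<and>
         (v \<le> N \<longrightarrow> LAK LA_b1_b1 N v = LAK LA_b1_1 N v)"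
proof (intro conjI impI)
  have N: "N > 0"
    using assms by simp
  show "LAK LA_1_b1 N v = LAK LA_1_1 N v" if "v \<ge> 3"
  proof -
    \<comment> \<open>The same arrays qualify for both variants, so the two maxima range over the
      same \<open>k\<close>.\<close>
    have "LA_exists LA_1_b1 N k v \<longleftrightarrow> LA_exists LA_1_1 N k v" for k
      by (simp add: LA_exists_def LA_1_b1_iff_LA_1_1[OF _ that] cong: conj_cong)
    then show ?thesis by (simp add: LAK_def)
  qed
  show "LAK LA_1_b1 N 2 = 2 ^ (N - 1) - 1"
    unfolding LAK_def
  proof (rule Greatest_equality)
    \<comment> \<open>For \<open>N = 1\<close> the value is 0, attained by an array without
      columns.\<close>
    show "LA_exists LA_1_b1 N (2 ^ (N - 1) - 1) 2"
      using N by (rule LA_1_b1_exists)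
    show "k \<le> 2 ^ (N - 1) - 1" if "LA_exists LA_1_b1 N k 2" for k
    proof -
      obtain S A where "is_array N k 2 S A" "LA_1_b1 N k S A"
        using \<open>LA_exists LA_1_b1 N k 2\<close> by (auto simp: LA_exists_def)
      then show ?thesis
        using N by (rule LA_1_b1_bound)
    qed
  qed
  show "LAK LA_b1_b1 N v = LAK LA_b1_1 N v"
  proof -
    have "LA_exists LA_b1_b1 N k v \<longleftrightarrow> LA_exists LA_b1_1 N k v" for k
      by (simp add: LA_exists_def LA_b1_b1_iff_LA_b1_1[OF _ assms(1) N] cong: conj_cong)
    then show ?thesis by (simp add: LAK_def)
  qed
qed

end
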